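(* Let $\alpha>0$. For every diagonal matrix $A=\mathrm{diag}(s_1,\dots,s_n)$ with $s_1\ge\cdots\ge s_n>0$, $$\int_{\mathbb{S}^{n-1}}\frac{dx}{|Ax|^{\alpha}}\approx\begin{cases}\dfrac{1}{s_1\cdots s_n\, s_n^{\alpha-n}}, & \text{if }\alpha\ge n,\\[2mm] \dfrac{1}{s_1\cdots s_{\lceil\alpha\rceil}\, s_{\lceil\alpha\rceil}^{\alpha-\lceil\alpha\rceil}}, & \text{if }\alpha<n\text{ is not an integer},\\[2mm] \dfrac{1+\log(s_\alpha/s_{\alpha+1})}{s_1\cdots s_\alpha}, & \text{if }\alpha<n\text{ is an integer},\end{cases}$$ where "$\approx$" means that the ratio of the two sides has positive upper and lower bounds depending only on $n$ and $\alpha$.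
   Context: $\mathbb{S}^{n-1}$ is the unit sphere of $\mathbb{R}^n$, $dx$ is the standard surface measure on it (counting measure on $\mathbb{S}^0=\{\pm1\}$ when $n=1$), and $|\cdot|$ is the Euclidean norm. $\lceil\alpha\rceil$ is the smallest integer greater than or equal to $\alpha$. *)

theory Defs
  imports "HOL-Analysis.Analysis"
begin

text \<open>Surface measure on the unit sphere, as the cone measure: a Borel set \<open>E\<close> of the sphere gets
  \<open>n\<close> times the volume of the cone \<open>{r x | x \<in> E, 0 < r < 1}\<close>. The factor \<open>n\<close> is the
  normalisation of the polar-coordinates formula \<open>dy = r^(n-1) dr dx\<close>. For \<open>n = 1\<close> this is the
  counting measure on the two unit vectors (\<open>emeasure_sphere_measure_singleton\<close>).\<close>

definition sphere_measure :: "'a::euclidean_space measure" where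
  "sphere_measure = scale_measure (of_nat DIM('a))
     (distr (restrict_space lborel (ball 0 1 - {0})) (restrict_space borel (sphere 0 1))
        (\<lambda>y. y /\<^sub>R norm y))"

lemma space_sphere_measure [simp]: "space (sphere_measure :: 'a::euclidean_space measure) = sphere 0 1"
  by (simp add: sphere_measure_def space_restrict_space space_scale_measure)

lemma sets_sphere_measure [simp]:
  "sets (sphere_measure :: 'a::euclidean_space measure) = sets (restrict_space borel (sphere 0 1))"
  by (simp add: sphere_measure_def)

lemma emeasure_sphere_measure:
  fixes E :: "'a::euclidean_space set"
  assumes E: "E \<in> sets borel" "E \<subseteq> sphere 0 1"
  shows "emeasure sphere_measure E =
    of_nat DIM('a) * emeasure lborel {r *\<^sub>R x | r x. 0 < r \<and> r < 1 \<and> x \<in> E}"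
proof -
  let ?B = "ball 0 1 - {0} :: 'a set" and ?p = "\<lambda>y::'a. y /\<^sub>R norm y"
  let ?M = "restrict_space lborel ?B" and ?S = "restrict_space borel (sphere 0 1 :: 'a set)"
  have "?p \<in> measurable ?M borel"
    by (intro measurable_restrict_space1) measurable
  then have p: "?p \<in> measurable ?M ?S"
    by (intro measurable_restrict_space2) (auto simp: space_restrict_space)
  have ES: "E \<in> sets ?S"
    using E by (auto simp: sets_restrict_space)
  have eq: "?p -` E \<inter> ?B = {r *\<^sub>R x | r x. 0 < r \<and> r < 1 \<and> x \<in> E}"
  proof (intro equalityI subsetI)
    fix y assume y: "y \<in> ?p -` E \<inter> ?B"
    then have "y = norm y *\<^sub>R ?p y" "0 < norm y" "norm y < 1" "?p y \<in> E" by auto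
    then show "y \<in> {r *\<^sub>R x | r x. 0 < r \<and> r < 1 \<and> x \<in> E}" by blast
  next
    fix y assume "y \<in> {r *\<^sub>R x | r x. 0 < r \<and> r < 1 \<and> x \<in> E}"
    then obtain r x where rx: "y = r *\<^sub>R x" "0 < r" "r < 1" "x \<in> E" by auto
    moreover have "norm x = 1" using rx E by auto
    ultimately show "y \<in> ?p -` E \<inter> ?B" by auto
  qed
  have "emeasure (distr ?M ?S ?p) E = emeasure ?M (?p -` E \<inter> ?B)"
    using emeasure_distr[OF p ES] by (simp add: space_restrict_space)
  also have "\<dots> = emeasure lborel (?p -` E \<inter> ?B)"
    by (intro emeasure_restrict_space) auto
  finally show ?thesis
    by (simp add: sphere_measure_def eq)
qed

lemma emeasure_sphere_measure_singleton:
  fixes u :: "'a::euclidean_space"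
  assumes "DIM('a) = 1" "norm u = 1"
  shows "emeasure sphere_measure {u} = 1"
proof -
  obtain b :: 'a where b: "Basis = {b}" using assms(1) card_1_singletonE by blast
  have nb: "b \<bullet> b = 1" using b by (intro inner_same_Basis) auto
  have rep: "x = (x \<bullet> b) *\<^sub>R b" for x :: 'a
    using euclidean_representation[of x] by (simp add: b)
  have ub: "u \<bullet> b = 1 \<or> u \<bullet> b = -1"
    using assms(2) by (simp add: norm_eq_1 euclidean_inner[of u u] b square_eq_1_iff)
  have box: "{r *\<^sub>R x | r x. 0 < r \<and> r < 1 \<and> x \<in> {u}} =
     (if u \<bullet> b = 1 then box 0 b else box (- b) 0)"
  proof -
    have "y \<in> {r *\<^sub>R x | r x. 0 < r \<and> r < 1 \<and> x \<in> {u}} \<longleftrightarrow> 0 < (y \<bullet> b) * (u \<bullet> b) \<and> (y \<bullet> b) * (u \<bullet> b) < 1" for y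
    proof -
      have "y = ((y \<bullet> b) * (u \<bullet> b)) *\<^sub>R u"
        using ub by (subst rep[of u], subst rep[of y]) auto
      moreover have "u \<bullet> b * (u \<bullet> b) = 1" using ub by auto
      ultimately show ?thesis by (auto simp: mult.assoc)
    qed
    then show ?thesis
      using ub nb by (auto simp: mem_box b)
  qed
  have "emeasure sphere_measure {u} = emeasure lborel (if u \<bullet> b = 1 then box 0 b else box (- b) 0)"
    using assms by (subst emeasure_sphere_measure) (simp_all only: box, simp_all)
  then show ?thesis
    using nb by (simp add: emeasure_lborel_box_eq b)
qed

text \<open>\<open>e\<close> numbers the coordinates of \<open>real^'n\<close> as \<open>e 1, \<dots>, e n\<close>; \<open>diag_matrix e s\<close> is
  \<open>diag(s 1, \<dots>, s n)\<close> with respect to this numbering. Values of \<open>s\<close> outside \<open>1..n\<close> play no role.\<close>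

definition diag_matrix :: "(nat \<Rightarrow> 'n) \<Rightarrow> (nat \<Rightarrow> real) \<Rightarrow> real^'n^'n::finite" where
  "diag_matrix e s = (\<chi> i j. if i = j then s (the_inv_into {1..CARD('n)} e i) else 0)"

text \<open>For \<open>\<alpha> > 0\<close>. In the last case \<open>\<alpha> < n\<close> is an integer, so \<open>k = \<alpha>\<close> and \<open>k + 1 \<le> n\<close>.\<close>

definition sphere_bound :: "nat \<Rightarrow> real \<Rightarrow> (nat \<Rightarrow> real) \<Rightarrow> real" where
  "sphere_bound n \<alpha> s =
    (let k = nat \<lceil>\<alpha>\<rceil> in
     if \<alpha> \<ge> real n then 1 / ((\<Prod>i=1..n. s i) * s n powr (\<alpha> - real n))
     else if \<alpha> \<notin> \<int> then 1 / ((\<Prod>i=1..k. s i) * s k powr (\<alpha> - real k))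
     else (1 + ln (s k / s (k + 1))) / (\<Prod>i=1..k. s i))"

end

theory Submission
  imports Defs
begin

text \<open>The layer-cake formula gives
  \<open>\<integral> |Ax|^(-\<alpha>) dx = \<alpha> \<integral> t^(-\<alpha>-1) \<sigma>{x. |Ax| \<le> t} dt\<close>. Comparing the cone over the
  sublevel set with boxes shows that \<open>\<sigma>{x. |Ax| \<le> t}\<close> is comparable, up to a rescaling of \<open>t\<close>, to
  \<open>P(t) = \<Prod>i\<le>n. min 1 (t / s i)\<close> for \<open>t \<ge> s n\<close>, and it vanishes for \<open>t < s n\<close>. Since
  \<open>P(t) \<le> t^k / (s 1 \<cdots> s k)\<close> for every \<open>k \<le> n\<close>, with equality for \<open>s (k+1) \<le> t \<le> s k\<close>, the integral
  of \<open>t^(-\<alpha>-1) P(t)\<close> concentrates near \<open>t = s k\<close> with \<open>k = \<lceil>\<alpha>\<rceil>\<close> (or \<open>k = n\<close> if \<open>\<alpha> \<ge> n\<close>). When \<open>\<alpha> = k < n\<close>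
  the integrand is a multiple of \<open>1/t\<close> on \<open>[s (k+1), s k]\<close>, which produces the logarithm.\<close>

section \<open>Finiteness of the sphere measure, integrals of powers, and the layer-cake
  formula\<close>

lemma sphere_measure_finite: "finite_measure (sphere_measure :: 'a::euclidean_space measure)"
proof (rule finite_measureI)
  have "{r *\<^sub>R x | r x. 0 < r \<and> r < 1 \<and> x \<in> (sphere 0 1 :: 'a set)} \<subseteq> cball 0 1"
    by auto
  then have "emeasure lborel {r *\<^sub>R x | r x. 0 < r \<and> r < 1 \<and> x \<in> (sphere 0 1 :: 'a set)}
      \<le> emeasure lborel (cball 0 1 :: 'a set)"
    by (intro emeasure_mono) auto
  also have "\<dots> < \<infinity>"
    by (intro emeasure_bounded_finite) auto
  finally show "emeasure (sphere_measure :: 'a measure) (space sphere_measure) \<noteq> \<infinity>"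
    by (simp add: emeasure_sphere_measure ennreal_mult_eq_top_iff less_top)
qed

lemma nn_integral_powr_tail:
  fixes a p :: real
  assumes "0 < a" "p < 0"
  shows "(\<integral>\<^sup>+t. ennreal (t powr (p - 1)) * indicator {a..} t \<partial>lborel) = ennreal (a powr p / - p)"
  using has_integral_powr_to_inf[of "p - 1" a] assms
  by (intro nn_integral_has_integral_lebesgue') auto

lemma nn_integral_powr_head:
  fixes a p :: real
  assumes "0 < a" "0 < p"
  shows "(\<integral>\<^sup>+t. ennreal (t powr (p - 1)) * indicator {0..a} t \<partial>lborel) = ennreal (a powr p / p)"
  using has_integral_powr_from_0[of "p - 1" a] assms
  by (intro nn_integral_has_integral_lebesgue') auto

lemma nn_integral_inverse_Icc:
  fixes a b :: real
  assumes "0 < a" "a \<le> b"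
  shows "(\<integral>\<^sup>+t. ennreal (t powr - 1) * indicator {a..b} t \<partial>lborel) = ennreal (ln (b / a))"
proof -
  have "(\<integral>\<^sup>+t. ennreal (t powr - 1) * indicator {a..b} t \<partial>lborel) = ennreal (ln b - ln a)"
    using assms
    by (intro nn_integral_FTC_Icc)
       (auto intro!: derivative_eq_intros simp: has_real_derivative_iff_has_vector_derivative[symmetric] powr_minus_divide)
  then show ?thesis
    using assms by (simp add: ln_div)
qed

text \<open>Each value \<open>g x powr - \<alpha>\<close> is the integral of
  \<open>\<alpha> * t powr (- \<alpha> - 1)\<close> over \<open>t \<ge> g x\<close>; exchanging the
  two nonnegative integrals leaves, for fixed \<open>t\<close>, the measure of the sublevel
  set.\<close>

lemma nn_integral_powr_minus_layer_cake:
  fixes g :: "'a \<Rightarrow> real"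
  assumes M: "sigma_finite_measure M" and g [measurable]: "g \<in> borel_measurable M"
    and pos: "\<And>x. x \<in> space M \<Longrightarrow> 0 < g x" and "0 < \<alpha>"
  shows "(\<integral>\<^sup>+x. ennreal (g x powr - \<alpha>) \<partial>M) =
    (\<integral>\<^sup>+t. ennreal (\<alpha> * t powr (- \<alpha> - 1)) * emeasure M {x \<in> space M. g x \<le> t} \<partial>lborel)"
proof -
  interpret M: sigma_finite_measure M by (fact M)
  interpret pair_sigma_finite M "lborel :: real measure"
    by unfold_locales
  have "(\<integral>\<^sup>+x. ennreal (g x powr - \<alpha>) \<partial>M) =
    (\<integral>\<^sup>+x. (\<integral>\<^sup>+t. ennreal (\<alpha> * t powr (- \<alpha> - 1)) * indicator {g x..} t \<partial>lborel) \<partial>M)"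
  proof (rule nn_integral_cong)
    fix x assume x: "x \<in> space M"
    have "(\<integral>\<^sup>+t. ennreal (\<alpha> * t powr (- \<alpha> - 1)) * indicator {g x..} t \<partial>lborel) =
       ennreal \<alpha> * (\<integral>\<^sup>+t. ennreal (t powr (- \<alpha> - 1)) * indicator {g x..} t \<partial>lborel)"
      using assms(4) by (subst nn_integral_cmult[symmetric]) (auto simp: ennreal_mult mult.assoc)
    also have "\<dots> = ennreal (g x powr - \<alpha>)"
      using assms(4) pos[OF x] by (subst nn_integral_powr_tail) (auto simp: ennreal_mult[symmetric])
    finally show "ennreal (g x powr - \<alpha>) =
      (\<integral>\<^sup>+t. ennreal (\<alpha> * t powr (- \<alpha> - 1)) * indicator {g x..} t \<partial>lborel)" ..
  qed
  also have "\<dots> = (\<integral>\<^sup>+t. (\<integral>\<^sup>+x. ennreal (\<alpha> * t powr (- \<alpha> - 1)) * indicator {g x..} t \<partial>M) \<partial>lborel)"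
  proof (rule Fubini'[symmetric])
    \<comment> \<open>Writing the indicator over the set of pairs with
      \<open>g (fst z) \<le> snd z\<close> makes the joint measurability evident.\<close>
    have "(\<lambda>(x, t). ennreal (\<alpha> * t powr (- \<alpha> - 1)) * indicator {z. g (fst z) \<le> snd z} (x, t))
      \<in> borel_measurable (M \<Otimes>\<^sub>M (lborel :: real measure))"
      by measurable
    then show "(\<lambda>(x, t). ennreal (\<alpha> * t powr (- \<alpha> - 1)) * indicator {g x..} t)
      \<in> borel_measurable (M \<Otimes>\<^sub>M (lborel :: real measure))"
      by (simp add: indicator_def)
  qed
  also have "\<dots> = (\<integral>\<^sup>+t. ennreal (\<alpha> * t powr (- \<alpha> - 1)) * emeasure M {x \<in> space M. g x \<le> t} \<partial>lborel)"
  proof (rule nn_integral_cong)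
    fix t :: real
    have "(\<integral>\<^sup>+x. ennreal (\<alpha> * t powr (- \<alpha> - 1)) * indicator {g x..} t \<partial>M) =
      (\<integral>\<^sup>+x. ennreal (\<alpha> * t powr (- \<alpha> - 1)) * indicator {x \<in> space M. g x \<le> t} x \<partial>M)"
      by (rule nn_integral_cong) (auto simp: indicator_def)
    then show "(\<integral>\<^sup>+x. ennreal (\<alpha> * t powr (- \<alpha> - 1)) * indicator {g x..} t \<partial>M) =
      ennreal (\<alpha> * t powr (- \<alpha> - 1)) * emeasure M {x \<in> space M. g x \<le> t}"
      by (simp add: nn_integral_cmult_indicator)
  qed
  finally show ?thesis .
qed

section \<open>Two-sided box estimates for the sublevel sets on the sphere\<close>

lemma sublevel_sphere_sets:
  fixes A :: "real^'n::finite^'n"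
  shows "{x \<in> sphere 0 1. norm (A *v x) \<le> t} \<in> sets borel"
proof -
  have "closed {x. norm (A *v x) \<le> t}"
    by (intro closed_Collect_le continuous_intros matrix_vector_mult_linear_continuous_on)
  then have "closed (sphere 0 1 \<inter> {x. norm (A *v x) \<le> t})"
    by (intro closed_Int) auto
  also have "sphere 0 1 \<inter> {x. norm (A *v x) \<le> t} = {x \<in> sphere 0 1. norm (A *v x) \<le> t}"
    by auto
  finally show ?thesis by (rule borel_closed)
qed

lemma emeasure_lborel_cbox_cart:
  fixes a b :: "real^'n::finite"
  assumes "\<And>i. a $ i \<le> b $ i"
  shows "emeasure lborel (cbox a b) = ennreal (\<Prod>i\<in>UNIV. b $ i - a $ i)"
proof -
  have "cbox a b \<noteq> {}"
    using assms by (auto simp: interval_ne_empty_cart)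
  then show ?thesis
    using content_cbox_cart[of a b] emeasure_lborel_cbox_finite[of a b]
    by (subst emeasure_eq_ennreal_measure) auto
qed

text \<open>On the sublevel set both \<open>\<bar>x $ i\<bar> \<le> 1\<close> and
  \<open>w i * \<bar>x $ i\<bar> \<le> t\<close> hold, so the cone over it lies in a centred box
  with half-sides \<open>min 1 (t / w i)\<close>. The factor \<open>CARD('n)\<close> is the
  normalisation of \<open>sphere_measure\<close>; the power of 2 comes from passing from half-sides
  to sides.\<close>

lemma sublevel_sphere_measure_le:
  fixes A :: "real^'n::finite^'n" and w :: "'n \<Rightarrow> real" and t :: real
  assumes A: "\<And>x i. (A *v x) $ i = w i * x $ i" and w: "\<And>i. 0 < w i" and "0 < t"
  shows "emeasure sphere_measure {x \<in> sphere 0 1. norm (A *v x) \<le> t}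
    \<le> ennreal (real CARD('n) * 2 ^ CARD('n) * (\<Prod>i\<in>UNIV. min 1 (t / w i)))"
proof -
  define v :: "real^'n" where "v = (\<chi> i. min 1 (t / w i))"
  have "{r *\<^sub>R x | r x. 0 < r \<and> r < 1 \<and> x \<in> {x \<in> sphere 0 1. norm (A *v x) \<le> t}} \<subseteq> cbox (- v) v"
  proof safe
    fix r :: real and x :: "real^'n"
    assume r: "0 < r" "r < 1" and x: "x \<in> sphere 0 1" "norm (A *v x) \<le> t"
    have "\<bar>r * x $ i\<bar> \<le> v $ i" for i
    proof -
      have "\<bar>x $ i\<bar> \<le> 1"
        using component_le_norm_cart[of x i] x by simp
      moreover have "w i * \<bar>x $ i\<bar> \<le> t"
        using component_le_norm_cart[of "A *v x" i] x w[of i] A by (simp add: abs_mult)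
      then have "\<bar>x $ i\<bar> \<le> t / w i"
        using w[of i] by (simp add: field_simps)
      moreover have "\<bar>r * x $ i\<bar> \<le> \<bar>x $ i\<bar>"
        using r by (simp add: abs_mult mult_left_le_one_le)
      ultimately show ?thesis by (simp add: v_def)
    qed
    then show "r *\<^sub>R x \<in> cbox (- v) v"
      by (auto simp: mem_box_cart abs_le_iff minus_le_iff)
  qed
  then have "emeasure lborel {r *\<^sub>R x | r x. 0 < r \<and> r < 1 \<and> x \<in> {x \<in> sphere 0 1. norm (A *v x) \<le> t}}
      \<le> emeasure lborel (cbox (- v) v)"
    by (intro emeasure_mono) auto
  also have "\<dots> = ennreal (\<Prod>i\<in>UNIV. 2 * min 1 (t / w i))"
  proof -
    have "0 \<le> v $ i" for i
      using w[of i] \<open>0 < t\<close> by (simp add: v_def)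
    then show ?thesis
      by (subst emeasure_lborel_cbox_cart) (auto simp: v_def intro: order_trans[of _ 0])
  qed
  finally have "of_nat DIM(real^'n) * emeasure lborel {r *\<^sub>R x | r x. 0 < r \<and> r < 1 \<and> x \<in> {x \<in> sphere 0 1. norm (A *v x) \<le> t}}
    \<le> of_nat DIM(real^'n) * ennreal (\<Prod>i\<in>UNIV. 2 * min 1 (t / w i))"
    by (rule mult_left_mono) auto
  also have "\<dots> = ennreal (real CARD('n) * 2 ^ CARD('n) * (\<Prod>i\<in>UNIV. min 1 (t / w i)))"
    using w \<open>0 < t\<close>
    by (simp add: ennreal_of_nat_eq_real_of_nat ennreal_mult[symmetric] prod.distrib mult.assoc
        prod_nonneg less_imp_le)
  finally show ?thesis
    using sublevel_sphere_sets by (subst emeasure_sphere_measure) auto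
qed

text \<open>The cone over the enlarged sublevel set contains a box whose volume is the product up to
  a constant. In the level \<open>2 * real CARD('n) * t\<close>, the factor \<open>CARD('n)\<close>
  comes from bounding the Euclidean norm by the sum of the coordinates, each at most
  \<open>t\<close>, and the factor 2 from dividing by a norm that is at least 1/2.\<close>

lemma sublevel_sphere_measure_ge:
  fixes A :: "real^'n::finite^'n" and w :: "'n \<Rightarrow> real" and t :: real
  assumes A: "\<And>x i. (A *v x) $ i = w i * x $ i" and w: "\<And>i. 0 < w i" and t: "w m \<le> t"
  shows "ennreal (real CARD('n) * (1 / (4 * real CARD('n))) ^ CARD('n) * (\<Prod>i\<in>UNIV. min 1 (t / w i)))
    \<le> emeasure sphere_measure {x \<in> sphere 0 1. norm (A *v x) \<le> 2 * real CARD('n) * t}"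
proof -
  define N where "N = real CARD('n)"
  have N: "1 \<le> N" by (simp add: N_def Suc_leI)
  have t0: "0 < t" using w[of m] t by linarith
  define v where "v i = min 1 (t / w i)" for i
  have v: "0 < v i" "v i \<le> 1" "w i * v i \<le> t" for i
    using w[of i] t0 by (auto simp: v_def min_def field_simps)
  define a :: "real^'n" where "a = (\<chi> i. if i = m then 1/2 else - (v i / (4 * N)))"
  define b :: "real^'n" where "b = (\<chi> i. if i = m then 3/4 else v i / (4 * N))"
  \<comment> \<open>Keeping coordinate \<open>m\<close> of the box in \<open>[1/2, 3/4]\<close> forces \<open>norm y \<ge> 1/2\<close>, so the projection to the sphere
    costs only the factor 2; since \<open>w m \<le> t\<close>, this coordinate does not violate the bound on \<open>A *v y\<close>.\<close>
  have "cbox a b \<subseteq> {r *\<^sub>R x | r x. 0 < r \<and> r < 1 \<and> x \<in> {x \<in> sphere 0 1. norm (A *v x) \<le> 2 * N * t}}"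
  proof
    fix y assume y: "y \<in> cbox a b"
    have ym: "1/2 \<le> y $ m" "y $ m \<le> 3/4"
      using y by (auto simp: mem_box_cart a_def b_def dest: spec[of _ m])
    have yi: "\<bar>y $ i\<bar> \<le> v i / (4 * N)" if "i \<noteq> m" for i
      using y that by (auto simp: mem_box_cart a_def b_def abs_le_iff dest: spec[of _ i])
    have ny: "1/2 \<le> norm y"
      using component_le_norm_cart[of y m] ym by linarith
    have "norm y \<le> (\<Sum>i\<in>UNIV. \<bar>y $ i\<bar>)"
      by (rule norm_le_l1_cart)
    also have "\<dots> = \<bar>y $ m\<bar> + (\<Sum>i\<in>UNIV - {m}. \<bar>y $ i\<bar>)"
      by (rule sum.remove) auto
    \<comment> \<open>The divisor \<open>4 * N\<close> in the box is chosen here: the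
      \<open>N - 1\<close> small coordinates together contribute less than 1/4, so the box stays
      inside the open unit ball.\<close>
    also have "\<dots> \<le> 3/4 + (\<Sum>i\<in>UNIV - {m}. 1 / (4 * N))"
    proof (intro add_mono sum_mono)
      fix i assume i: "i \<in> UNIV - {m}"
      then have "\<bar>y $ i\<bar> \<le> v i / (4 * N)" using yi by auto
      also have "\<dots> \<le> 1 / (4 * N)"
        using v[of i] N by (intro divide_right_mono) auto
      finally show "\<bar>y $ i\<bar> \<le> 1 / (4 * N)" .
    qed (use ym in auto)
    also have "\<dots> = 3/4 + (N - 1) / (4 * N)"
      by (simp add: card_Diff_singleton N_def Suc_leI)
    also have "\<dots> < 1" using N by (simp add: field_simps)
    finally have ny1: "norm y < 1" .
    have "norm (A *v y) \<le> (\<Sum>i\<in>UNIV. \<bar>(A *v y) $ i\<bar>)"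
      by (rule norm_le_l1_cart)
    also have "\<dots> \<le> (\<Sum>i\<in>(UNIV :: 'n set). t)"
    proof (rule sum_mono)
      fix i :: 'n
      have "\<bar>(A *v y) $ i\<bar> = w i * \<bar>y $ i\<bar>"
        using w[of i] by (simp add: A abs_mult)
      also have "\<dots> \<le> t"
      proof (cases "i = m")
        case True
        have "w m * \<bar>y $ m\<bar> \<le> w m * 1"
          using ym w[of m] by (intro mult_left_mono) auto
        then show ?thesis using True t by simp
      next
        case False
        have "v i / (4 * N) \<le> v i"
          using v[of i] N by (simp add: field_simps)
        then have "\<bar>y $ i\<bar> \<le> v i" using yi[OF False] by linarith
        then have "w i * \<bar>y $ i\<bar> \<le> w i * v i"
          using w[of i] by (intro mult_left_mono) auto
        then show ?thesis using v[of i] by linarith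
      qed
      finally show "\<bar>(A *v y) $ i\<bar> \<le> t" .
    qed
    also have "\<dots> = N * t" by (simp add: N_def)
    also have "N * t = 2 * N * t * (1/2)" by simp
    also have "\<dots> \<le> 2 * N * t * norm y"
      using N t0 ny by (intro mult_left_mono) auto
    finally have Ay: "norm (A *v y) \<le> 2 * N * t * norm y" .
    have "norm (A *v (y /\<^sub>R norm y)) = norm (A *v y) / norm y"
      by (simp only: matrix_vector_mult_scaleR norm_scaleR abs_inverse abs_norm_cancel divide_inverse_commute)
    also have "\<dots> \<le> 2 * N * t"
      using Ay ny by (intro mult_imp_div_pos_le) auto
    finally have "norm (A *v (y /\<^sub>R norm y)) \<le> 2 * N * t" .
    moreover have "y \<noteq> 0" using ny by auto
    ultimately show "y \<in> {r *\<^sub>R x | r x. 0 < r \<and> r < 1 \<and> x \<in> {x \<in> sphere 0 1. norm (A *v x) \<le> 2 * N * t}}"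
      using ny1 by (intro CollectI exI[of _ "norm y"] exI[of _ "y /\<^sub>R norm y"]) simp
  qed
  \<comment> \<open>Monotonicity of \<open>emeasure\<close> needs the larger set to be measurable.
    In homogeneous form the cone is the punctured unit ball intersected with the closed set
    \<open>norm (A *v y) \<le> 2 * N * t * norm y\<close>.\<close>
  moreover have "{r *\<^sub>R x | r x. 0 < r \<and> r < 1 \<and> x \<in> {x \<in> sphere 0 1. norm (A *v x) \<le> 2 * N * t}} \<in> sets lborel"
  proof -
    have "{r *\<^sub>R x | r x. 0 < r \<and> r < 1 \<and> x \<in> {x \<in> sphere 0 1. norm (A *v x) \<le> 2 * N * t}}
      = (ball 0 1 - {0}) \<inter> {y. norm (A *v y) \<le> 2 * N * t * norm y}" (is "?L = ?R")
    proof (intro equalityI subsetI)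
      fix y assume "y \<in> ?L"
      then obtain r x where "y = r *\<^sub>R x" "0 < r" "r < 1" "norm x = 1" "norm (A *v x) \<le> 2 * N * t"
        by auto
      then show "y \<in> ?R"
        by (auto simp: matrix_vector_mult_scaleR mult.commute)
    next
      fix y assume y: "y \<in> ?R"
      then have "norm (A *v (y /\<^sub>R norm y)) \<le> 2 * N * t"
        by (simp only: matrix_vector_mult_scaleR norm_scaleR abs_inverse abs_norm_cancel)
           (simp add: pos_divide_le_eq flip: divide_inverse_commute)
      then show "y \<in> ?L"
        using y by (intro CollectI exI[of _ "norm y"] exI[of _ "y /\<^sub>R norm y"]) simp
    qed
    moreover have "closed {y. norm (A *v y) \<le> 2 * N * t * norm y}"
      by (intro closed_Collect_le continuous_intros matrix_vector_mult_linear_continuous_on)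
    ultimately show ?thesis by auto
  qed
  ultimately have "emeasure lborel (cbox a b) \<le> emeasure lborel
      {r *\<^sub>R x | r x. 0 < r \<and> r < 1 \<and> x \<in> {x \<in> sphere 0 1. norm (A *v x) \<le> 2 * N * t}}"
    by (intro emeasure_mono) auto
  moreover have "ennreal ((1 / (4 * N)) ^ CARD('n) * (\<Prod>i\<in>UNIV. v i)) \<le> emeasure lborel (cbox a b)"
  proof -
    have "a $ i \<le> b $ i" for i
      using v[of i] N by (auto simp: a_def b_def intro: order_trans[of _ 0])
    then have "emeasure lborel (cbox a b) = ennreal (\<Prod>i\<in>UNIV. b $ i - a $ i)"
      by (rule emeasure_lborel_cbox_cart)
    moreover have "(\<Prod>i\<in>UNIV. 1 / (4 * N) * v i) \<le> (\<Prod>i\<in>UNIV. b $ i - a $ i)"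
    proof (rule prod_mono, intro conjI)
      fix i
      show "0 \<le> 1 / (4 * N) * v i" using v[of i] N by simp
      \<comment> \<open>The side in direction \<open>m\<close> is 1/4, which suffices because
        \<open>v m \<le> 1 \<le> N\<close>; every other side is
        \<open>v i / (2 * N)\<close>.\<close>
      show "1 / (4 * N) * v i \<le> b $ i - a $ i"
        using v[of i] N by (auto simp: a_def b_def field_simps)
    qed
    ultimately show ?thesis
      by (simp only: prod.distrib prod_constant) (rule ennreal_leI)
  qed
  ultimately have "of_nat DIM(real^'n) * ennreal ((1 / (4 * N)) ^ CARD('n) * (\<Prod>i\<in>UNIV. v i))
    \<le> of_nat DIM(real^'n) * emeasure lborel
      {r *\<^sub>R x | r x. 0 < r \<and> r < 1 \<and> x \<in> {x \<in> sphere 0 1. norm (A *v x) \<le> 2 * N * t}}"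
    by (intro mult_left_mono) auto
  also have "of_nat DIM(real^'n) * ennreal ((1 / (4 * N)) ^ CARD('n) * (\<Prod>i\<in>UNIV. v i))
    = ennreal (N * (1 / (4 * N)) ^ CARD('n) * (\<Prod>i\<in>UNIV. v i))"
  proof -
    have "0 \<le> (1 / (4 * N)) ^ CARD('n) * (\<Prod>i\<in>UNIV. v i)"
      using N v by (intro mult_nonneg_nonneg prod_nonneg) (auto simp: less_imp_le)
    then show ?thesis
      using N by (simp add: ennreal_of_nat_eq_real_of_nat ennreal_mult[symmetric] N_def mult.assoc)
  qed
  finally show ?thesis
    using sublevel_sphere_sets unfolding v_def N_def by (subst emeasure_sphere_measure) auto
qed

section \<open>The product of truncated ratios and its monomial majorants\<close>

lemma prod_min_le:
  fixes s :: "nat \<Rightarrow> real"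
  assumes s: "\<And>i. i \<in> {1..n} \<Longrightarrow> 0 < s i" and "k \<le> n" and "0 < t"
  shows "(\<Prod>i=1..n. min 1 (t / s i)) \<le> t ^ k / (\<Prod>i=1..k. s i)"
proof -
  have "(\<Prod>i=1..n. min 1 (t / s i)) = (\<Prod>i=1..k. min 1 (t / s i)) * (\<Prod>i=Suc k..n. min 1 (t / s i))"
    using \<open>k \<le> n\<close> prod.ub_add_nat[of 1 k "\<lambda>i. min 1 (t / s i)" "n - k"] by simp
  \<comment> \<open>The first \<open>k\<close> minima are bounded by their second argument, the
    remaining ones by 1.\<close>
  also have "\<dots> \<le> (\<Prod>i=1..k. t / s i) * 1"
  proof (intro mult_mono prod_mono prod_le_1 conjI prod_nonneg)
    fix i
    show "0 \<le> min 1 (t / s i)" if "i \<in> {1..k}"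
      using s[of i] that assms by (auto simp: less_imp_le)
    show "0 \<le> min 1 (t / s i)" if "i \<in> {Suc k..n}"
      using s[of i] that assms by (auto simp: less_imp_le)
    show "0 \<le> min 1 (t / s i)" if "i \<in> {Suc k..n}"
      using s[of i] that assms by (auto simp: less_imp_le)
    show "0 \<le> t / s i" if "i \<in> {1..k}"
      using s[of i] that assms by (auto simp: less_imp_le)
  qed auto
  also have "\<dots> = t ^ k / (\<Prod>i=1..k. s i)"
    by (simp add: prod_dividef)
  finally show ?thesis .
qed

text \<open>The lower bounds rest on this equality: it is applied at the point
  \<open>t = s k\<close>, and on all of \<open>[s (k + 1), s k]\<close> for the logarithm.\<close>

lemma prod_min_eq:
  fixes s :: "nat \<Rightarrow> real"
  assumes s: "\<And>i. i \<in> {1..n} \<Longrightarrow> 0 < s i" and "k \<le> n"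
    and le: "\<And>i. i \<in> {1..k} \<Longrightarrow> t \<le> s i" and ge: "\<And>i. i \<in> {Suc k..n} \<Longrightarrow> s i \<le> t"
  shows "(\<Prod>i=1..n. min 1 (t / s i)) = t ^ k / (\<Prod>i=1..k. s i)"
proof -
  have "(\<Prod>i=1..n. min 1 (t / s i)) = (\<Prod>i=1..k. min 1 (t / s i)) * (\<Prod>i=Suc k..n. min 1 (t / s i))"
    using \<open>k \<le> n\<close> prod.ub_add_nat[of 1 k "\<lambda>i. min 1 (t / s i)" "n - k"] by simp
  also have "(\<Prod>i=1..k. min 1 (t / s i)) = (\<Prod>i=1..k. t / s i)"
  proof (rule prod.cong)
    fix i assume i: "i \<in> {1..k}"
    then have "0 < s i" using s assms(2) by auto
    then show "min 1 (t / s i) = t / s i" using le[OF i] by (simp add: min_def)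
  qed simp
  also have "(\<Prod>i=Suc k..n. min 1 (t / s i)) = 1"
  proof (rule prod.neutral, rule ballI)
    fix i assume i: "i \<in> {Suc k..n}"
    then have "0 < s i" using s by auto
    then show "min 1 (t / s i) = 1" using ge[OF i] by (simp add: min_def)
  qed
  finally show ?thesis by (simp add: prod_dividef)
qed

section \<open>Upper and lower bounds for the radial integral over ranges of
  \<open>t\<close>\<close>

definition decreasing_positive :: "nat \<Rightarrow> (nat \<Rightarrow> real) \<Rightarrow> bool" where
  "decreasing_positive n s \<longleftrightarrow> (\<forall>i j. 1 \<le> i \<and> i \<le> j \<and> j \<le> n \<longrightarrow> s j \<le> s i) \<and> 0 < s n"

lemma decreasing_positiveD:
  assumes "decreasing_positive n s" "1 \<le> i" "i \<le> n"
  shows "0 < s i"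
  using assms unfolding decreasing_positive_def by (meson order_less_le_trans order_refl)

text \<open>This is the layer-cake integrand with the measure of the sublevel set replaced by its
  model product, and without the factor \<open>\<alpha>\<close>.\<close>

definition radial_density :: "nat \<Rightarrow> real \<Rightarrow> (nat \<Rightarrow> real) \<Rightarrow> real \<Rightarrow> real" where
  "radial_density n \<alpha> s t = t powr (- \<alpha> - 1) * (\<Prod>i=1..n. min 1 (t / s i))"

text \<open>This is \<open>t powr - \<alpha>\<close> times the majorant
  \<open>t ^ k / (\<Prod>i=1..k. s i)\<close>, evaluated at \<open>t = s k\<close>. The first two
  cases of \<open>sphere_bound\<close> have this form, with \<open>k = n\<close> and
  \<open>k = \<lceil>\<alpha>\<rceil>\<close>; for \<open>\<alpha> = k < n\<close> the values at
  \<open>k\<close> and \<open>k + 1\<close> both equal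
  \<open>1 / (\<Prod>i=1..k. s i)\<close>.\<close>

definition block_bound :: "real \<Rightarrow> (nat \<Rightarrow> real) \<Rightarrow> nat \<Rightarrow> real" where
  "block_bound \<alpha> s k = s k powr (real k - \<alpha>) / (\<Prod>i=1..k. s i)"

lemma radial_density_measurable [measurable]: "radial_density n \<alpha> s \<in> borel_measurable borel"
  unfolding radial_density_def by measurable

text \<open>The index \<open>k\<close> is free: the pure power on the right is integrable at
  infinity for \<open>real k < \<alpha>\<close> and at zero for \<open>real k > \<alpha>\<close>.
  The exponent is written as \<open>(real k - \<alpha>) - 1\<close> to match the power
  integrals.\<close>

lemma radial_density_le:
  assumes "decreasing_positive n s" "k \<le> n" "0 < t"
  shows "radial_density n \<alpha> s t \<le> 1 / (\<Prod>i=1..k. s i) * t powr ((real k - \<alpha>) - 1)"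
proof -
  have "radial_density n \<alpha> s t \<le> t powr (- \<alpha> - 1) * (t ^ k / (\<Prod>i=1..k. s i))"
    unfolding radial_density_def
    using assms by (intro mult_left_mono prod_min_le) (auto intro: decreasing_positiveD)
  also have "\<dots> = 1 / (\<Prod>i=1..k. s i) * (t powr (- \<alpha> - 1) * t powr real k)"
    using assms by (simp add: powr_realpow)
  also have "t powr (- \<alpha> - 1) * t powr real k = t powr ((real k - \<alpha>) - 1)"
    by (simp add: powr_add[symmetric] algebra_simps)
  finally show ?thesis .
qed

lemma prod_pos_decreasing:
  assumes "decreasing_positive n s" "k \<le> n"
  shows "0 < (\<Prod>i=1..k. s i)"
  using assms by (intro prod_pos) (auto intro: decreasing_positiveD)

lemma block_bound_pos:
  assumes "decreasing_positive n s" "1 \<le> k" "k \<le> n"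
  shows "0 < block_bound \<alpha> s k"
  unfolding block_bound_def using assms prod_pos_decreasing[of n s k] decreasing_positiveD[of n s k] by simp

text \<open>The majorants of indices \<open>k - 1\<close> and \<open>k\<close> agree at
  \<open>t = s k\<close>. A tail estimate made with index \<open>k - 1\<close> can therefore be
  expressed by the block bound of index \<open>k\<close>.\<close>

lemma block_bound_pred:
  assumes "decreasing_positive n s" "1 \<le> k" "k \<le> n"
  shows "1 / (\<Prod>i=1..k-1. s i) * s k powr (real k - 1 - \<alpha>) = block_bound \<alpha> s k"
proof -
  have sk: "0 < s k" using assms by (rule decreasing_positiveD)
  have "(\<Prod>i=1..k. s i) = (\<Prod>i=1..k-1. s i) * s k"
    using assms(2) by (cases k) auto
  moreover have "s k powr (real k - \<alpha>) = s k powr (real k - 1 - \<alpha>) * s k"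
    using sk powr_add[of "s k" "real k - 1 - \<alpha>" 1] by simp
  ultimately show ?thesis
    using sk prod_pos_decreasing[of n s "k - 1"] assms by (simp add: block_bound_def)
qed

lemma nn_integral_radial_density_le:
  assumes s: "decreasing_positive n s" and k: "k \<le> n" and S: "S \<subseteq> {0<..}" "S \<in> sets borel"
    and I: "(\<integral>\<^sup>+t. ennreal (t powr ((real k - \<alpha>) - 1)) * indicator S t \<partial>lborel) \<le> ennreal I" "0 \<le> I"
  shows "(\<integral>\<^sup>+t. ennreal (radial_density n \<alpha> s t) * indicator S t \<partial>lborel) \<le> ennreal (1 / (\<Prod>i=1..k. s i) * I)"
proof -
  have p: "0 < (\<Prod>i=1..k. s i)" using s k by (rule prod_pos_decreasing)
  have "(\<integral>\<^sup>+t. ennreal (radial_density n \<alpha> s t) * indicator S t \<partial>lborel) \<le>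
    (\<integral>\<^sup>+t. ennreal (1 / (\<Prod>i=1..k. s i)) * (ennreal (t powr ((real k - \<alpha>) - 1)) * indicator S t) \<partial>lborel)"
  proof (rule nn_integral_mono)
    fix t :: real
    show "ennreal (radial_density n \<alpha> s t) * indicator S t \<le>
      ennreal (1 / (\<Prod>i=1..k. s i)) * (ennreal (t powr ((real k - \<alpha>) - 1)) * indicator S t)"
      using radial_density_le[OF s k, of t \<alpha>] S(1) p
      by (auto simp: indicator_def ennreal_mult[symmetric] simp del: times_divide_eq_left intro!: ennreal_leI)
  qed
  also have "\<dots> = ennreal (1 / (\<Prod>i=1..k. s i)) * (\<integral>\<^sup>+t. ennreal (t powr ((real k - \<alpha>) - 1)) * indicator S t \<partial>lborel)"
    using S(2) by (intro nn_integral_cmult) auto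
  also have "\<dots> \<le> ennreal (1 / (\<Prod>i=1..k. s i)) * ennreal I"
    using I by (intro mult_left_mono) auto
  also have "\<dots> = ennreal (1 / (\<Prod>i=1..k. s i) * I)"
    using p I(2) by (subst ennreal_mult) auto
  finally show ?thesis .
qed

text \<open>Beyond \<open>s k\<close> the majorant of index \<open>k - 1\<close> is used; the
  hypothesis on \<open>\<alpha>\<close> makes it integrable at infinity.\<close>

lemma nn_integral_radial_density_tail:
  assumes s: "decreasing_positive n s" and k: "1 \<le> k" "k \<le> n" and \<alpha>: "real k - 1 < \<alpha>"
  shows "(\<integral>\<^sup>+t. ennreal (radial_density n \<alpha> s t) * indicator {s k..} t \<partial>lborel)
    \<le> ennreal (block_bound \<alpha> s k / (\<alpha> - real k + 1))"
proof -
  have sk: "0 < s k" using s k by (rule decreasing_positiveD)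
  have "(\<integral>\<^sup>+t. ennreal (radial_density n \<alpha> s t) * indicator {s k..} t \<partial>lborel)
    \<le> ennreal (1 / (\<Prod>i=1..k-1. s i) * (s k powr (real k - 1 - \<alpha>) / (\<alpha> - real k + 1)))"
  proof (rule nn_integral_radial_density_le[OF s])
    show "(\<integral>\<^sup>+t. ennreal (t powr (real (k - 1) - \<alpha> - 1)) * indicator {s k..} t \<partial>lborel)
      \<le> ennreal (s k powr (real k - 1 - \<alpha>) / (\<alpha> - real k + 1))"
      using nn_integral_powr_tail[OF sk, of "real (k - 1) - \<alpha>"] k \<alpha> by (simp add: algebra_simps)
  qed (use sk k \<alpha> in auto)
  then show ?thesis
    by (simp only: times_divide_eq_right block_bound_pred[OF s k])
qed

text \<open>Below \<open>s k\<close> the majorant of index \<open>k\<close> is used; the hypothesis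
  on \<open>\<alpha>\<close> makes it integrable at zero.\<close>

lemma nn_integral_radial_density_head:
  assumes s: "decreasing_positive n s" and k: "1 \<le> k" "k \<le> n" and \<alpha>: "\<alpha> < real k"
  shows "(\<integral>\<^sup>+t. ennreal (radial_density n \<alpha> s t) * indicator {0<..s k} t \<partial>lborel)
    \<le> ennreal (block_bound \<alpha> s k / (real k - \<alpha>))"
proof -
  have sk: "0 < s k" using s k by (rule decreasing_positiveD)
  have "(\<integral>\<^sup>+t. ennreal (radial_density n \<alpha> s t) * indicator {0<..s k} t \<partial>lborel)
    \<le> ennreal (1 / (\<Prod>i=1..k. s i) * (s k powr (real k - \<alpha>) / (real k - \<alpha>)))"
  proof (rule nn_integral_radial_density_le[OF s])
    have "(\<integral>\<^sup>+t. ennreal (t powr (real k - \<alpha> - 1)) * indicator {0<..s k} t \<partial>lborel)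
      \<le> (\<integral>\<^sup>+t. ennreal (t powr (real k - \<alpha> - 1)) * indicator {0..s k} t \<partial>lborel)"
      by (intro nn_integral_mono) (auto simp: indicator_def)
    then show "(\<integral>\<^sup>+t. ennreal (t powr (real k - \<alpha> - 1)) * indicator {0<..s k} t \<partial>lborel)
      \<le> ennreal (s k powr (real k - \<alpha>) / (real k - \<alpha>))"
      using nn_integral_powr_head[OF sk, of "real k - \<alpha>"] \<alpha> by simp
  qed (use sk k \<alpha> in auto)
  then show ?thesis by (simp add: block_bound_def)
qed

text \<open>With \<open>\<alpha> = k\<close> the majorant of index \<open>k\<close> is a constant
  times \<open>1 / t\<close>, whose integral is the logarithm.\<close>

lemma nn_integral_radial_density_middle_le:
  assumes s: "decreasing_positive n s" and k: "1 \<le> k" "k < n"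
  shows "(\<integral>\<^sup>+t. ennreal (radial_density n (real k) s t) * indicator {s (k + 1)..s k} t \<partial>lborel)
    \<le> ennreal (1 / (\<Prod>i=1..k. s i) * ln (s k / s (k + 1)))"
proof (rule nn_integral_radial_density_le[OF s])
  have sk: "0 < s (k + 1)" using s k by (intro decreasing_positiveD) auto
  have le: "s (k + 1) \<le> s k" using s k by (auto simp: decreasing_positive_def)
  show "(\<integral>\<^sup>+t. ennreal (t powr (real k - real k - 1)) * indicator {s (k + 1)..s k} t \<partial>lborel)
    \<le> ennreal (ln (s k / s (k + 1)))"
    using nn_integral_inverse_Icc[OF sk le] by simp
  show "0 \<le> ln (s k / s (k + 1))" using sk le by (intro ln_ge_zero) (simp add: pos_le_divide_eq)
  show "{s (k + 1)..s k} \<subseteq> {0<..}" using sk by auto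
qed (use k in auto)

text \<open>The product increases with \<open>t\<close>, so for \<open>t \<ge> s k\<close> it is at
  least its value \<open>P\<close> at \<open>t = s k\<close>. Integrating
  \<open>P * t powr (- \<alpha> - 1)\<close> from \<open>s k\<close> on already gives the block
  bound.\<close>

lemma nn_integral_radial_density_ge_block:
  assumes s: "decreasing_positive n s" and k: "1 \<le> k" "k \<le> n" and \<alpha>: "0 < \<alpha>"
  shows "ennreal (block_bound \<alpha> s k / \<alpha>)
    \<le> (\<integral>\<^sup>+t. ennreal (radial_density n \<alpha> s t) * indicator {s n..} t \<partial>lborel)"
proof -
  have sk: "0 < s k" using s k by (rule decreasing_positiveD)
  define P where "P = s k ^ k / (\<Prod>i=1..k. s i)"
  have P0: "0 \<le> P"
    using sk prod_pos_decreasing[OF s k(2)] by (simp add: P_def)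
  have P: "P \<le> (\<Prod>i=1..n. min 1 (t / s i))" if "s k \<le> t" for t
  proof -
    have "P = (\<Prod>i=1..n. min 1 (s k / s i))"
      unfolding P_def using s k
      by (intro prod_min_eq[symmetric]) (auto intro: decreasing_positiveD simp: decreasing_positive_def)
    also have "\<dots> \<le> (\<Prod>i=1..n. min 1 (t / s i))"
    proof (intro prod_mono conjI)
      fix i assume "i \<in> {1..n}"
      then have "0 < s i" using decreasing_positiveD[OF s] by auto
      then show "0 \<le> min 1 (s k / s i)" "min 1 (s k / s i) \<le> min 1 (t / s i)"
        using sk that by (auto intro!: min.coboundedI2 divide_right_mono)
    qed
    finally show ?thesis .
  qed
  have "block_bound \<alpha> s k / \<alpha> = P * (s k powr - \<alpha> / \<alpha>)"
    using sk powr_add[of "s k" "real k" "- \<alpha>"] by (simp add: block_bound_def P_def powr_realpow)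
  then have "ennreal (block_bound \<alpha> s k / \<alpha>) = ennreal P * (\<integral>\<^sup>+t. ennreal (t powr (- \<alpha> - 1)) * indicator {s k..} t \<partial>lborel)"
    using nn_integral_powr_tail[OF sk, of "- \<alpha>"] \<alpha> P0 by (simp add: ennreal_mult[symmetric])
  also have "\<dots> = (\<integral>\<^sup>+t. ennreal P * (ennreal (t powr (- \<alpha> - 1)) * indicator {s k..} t) \<partial>lborel)"
    by (intro nn_integral_cmult[symmetric]) auto
  also have "\<dots> \<le> (\<integral>\<^sup>+t. ennreal (radial_density n \<alpha> s t) * indicator {s n..} t \<partial>lborel)"
  proof (rule nn_integral_mono)
    fix t :: real
    have "s n \<le> s k" using s k by (auto simp: decreasing_positive_def)
    moreover have "P * t powr (- \<alpha> - 1) \<le> radial_density n \<alpha> s t" if "s k \<le> t"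
      unfolding radial_density_def using P[OF that]
      by (subst mult.commute) (intro mult_left_mono, auto)
    ultimately show "ennreal P * (ennreal (t powr (- \<alpha> - 1)) * indicator {s k..} t)
      \<le> ennreal (radial_density n \<alpha> s t) * indicator {s n..} t"
      using P0 by (auto simp: indicator_def ennreal_mult[symmetric] intro!: ennreal_leI)
  qed
  finally show ?thesis .
qed

text \<open>On \<open>[s (k + 1), s k]\<close>, a part of the range of integration, the density for
  \<open>\<alpha> = k\<close> is exactly a constant times \<open>1 / t\<close>.\<close>

lemma nn_integral_radial_density_ge_log:
  assumes s: "decreasing_positive n s" and k: "1 \<le> k" "k < n"
  shows "ennreal (1 / (\<Prod>i=1..k. s i) * ln (s k / s (k + 1)))
    \<le> (\<integral>\<^sup>+t. ennreal (radial_density n (real k) s t) * indicator {s n..} t \<partial>lborel)"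
proof -
  have sk: "0 < s (k + 1)" using s k by (intro decreasing_positiveD) auto
  have le: "s (k + 1) \<le> s k" using s k by (auto simp: decreasing_positive_def)
  have p: "0 < (\<Prod>i=1..k. s i)" using s k by (intro prod_pos_decreasing) auto
  have "ennreal (1 / (\<Prod>i=1..k. s i) * ln (s k / s (k + 1))) =
    ennreal (1 / (\<Prod>i=1..k. s i)) * (\<integral>\<^sup>+t. ennreal (t powr - 1) * indicator {s (k + 1)..s k} t \<partial>lborel)"
    using nn_integral_inverse_Icc[OF sk le] p sk le
    by (subst ennreal_mult) (auto intro!: ln_ge_zero simp: pos_le_divide_eq)
  also have "\<dots> = (\<integral>\<^sup>+t. ennreal (1 / (\<Prod>i=1..k. s i)) * (ennreal (t powr - 1) * indicator {s (k + 1)..s k} t) \<partial>lborel)"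
    by (intro nn_integral_cmult[symmetric]) auto
  also have "\<dots> \<le> (\<integral>\<^sup>+t. ennreal (radial_density n (real k) s t) * indicator {s n..} t \<partial>lborel)"
  proof (rule nn_integral_mono)
    fix t :: real
    have "s n \<le> s (k + 1)" using s k by (auto simp: decreasing_positive_def)
    moreover have "1 / (\<Prod>i=1..k. s i) * t powr - 1 = radial_density n (real k) s t"
      if t: "s (k + 1) \<le> t" "t \<le> s k"
    proof -
      have t0: "0 < t" using sk t by linarith
      have "(\<Prod>i=1..n. min 1 (t / s i)) = t ^ k / (\<Prod>i=1..k. s i)"
      proof (rule prod_min_eq)
        show "t \<le> s i" if "i \<in> {1..k}" for i
        proof -
          have "s k \<le> s i" using s k that by (auto simp: decreasing_positive_def)
          then show ?thesis using t by linarith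
        qed
        show "s i \<le> t" if "i \<in> {Suc k..n}" for i
        proof -
          have "s i \<le> s (k + 1)" using s k that by (auto simp: decreasing_positive_def)
          then show ?thesis using t by linarith
        qed
      qed (use k in \<open>auto intro: decreasing_positiveD[OF s]\<close>)
      moreover have "t powr (- real k - 1) * t ^ k = t powr - 1"
        using t0 powr_add[of t "- real k - 1" "real k"] by (simp add: powr_realpow)
      ultimately show ?thesis
        by (simp add: radial_density_def)
    qed
    ultimately show "ennreal (1 / (\<Prod>i=1..k. s i)) * (ennreal (t powr - 1) * indicator {s (k + 1)..s k} t)
      \<le> ennreal (radial_density n (real k) s t) * indicator {s n..} t"
      using p by (auto simp: indicator_def ennreal_mult[symmetric] simp del: times_divide_eq_left)
  qed
  finally show ?thesis .
qed

section \<open>Assembly of the three cases for the radial integral\<close>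

lemma nn_integral_indicator_Un_le:
  assumes [measurable]: "f \<in> borel_measurable M" "A \<in> sets M" "B \<in> sets M" and "S \<subseteq> A \<union> B"
  shows "(\<integral>\<^sup>+t. f t * indicator S t \<partial>M) \<le>
    (\<integral>\<^sup>+t. f t * indicator A t \<partial>M) + (\<integral>\<^sup>+t. f t * indicator B t \<partial>M)"
proof -
  have "(\<integral>\<^sup>+t. f t * indicator S t \<partial>M) \<le> (\<integral>\<^sup>+t. f t * indicator A t + f t * indicator B t \<partial>M)"
    using assms(4) by (intro nn_integral_mono) (auto simp: indicator_def)
  then show ?thesis by (simp add: nn_integral_add)
qed

text \<open>The constants are obtained before \<open>s\<close> is introduced, which gives the
  uniformity in \<open>s\<close>. The range starts at \<open>s n\<close> because the sublevel sets
  are empty below it; for \<open>\<alpha> \<ge> n\<close> the density is not integrable at zero, so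
  this cut-off is essential.\<close>

lemma nn_integral_radial_density_bounds:
  assumes \<alpha>: "0 < \<alpha>" and n: "1 \<le> n"
  obtains c C where "0 < c" "0 < C"
    "\<And>s. decreasing_positive n s \<Longrightarrow> 0 < sphere_bound n \<alpha> s"
    "\<And>s. decreasing_positive n s \<Longrightarrow> ennreal (c * sphere_bound n \<alpha> s)
        \<le> (\<integral>\<^sup>+t. ennreal (radial_density n \<alpha> s t) * indicator {s n..} t \<partial>lborel)"
    "\<And>s. decreasing_positive n s \<Longrightarrow>
        (\<integral>\<^sup>+t. ennreal (radial_density n \<alpha> s t) * indicator {s n..} t \<partial>lborel)
        \<le> ennreal (C * sphere_bound n \<alpha> s)"
proof -
  define k where "k = nat \<lceil>\<alpha>\<rceil>"
  have k1: "1 \<le> k" and k\<alpha>: "real k - 1 < \<alpha>" "\<alpha> \<le> real k"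
    using \<alpha> unfolding k_def by linarith+
  consider "real n \<le> \<alpha>" | "\<alpha> < real n" "\<alpha> \<notin> \<int>" | "\<alpha> < real n" "\<alpha> \<in> \<int>"
    by linarith
  then show thesis
  proof cases
    case 1
    have eq: "sphere_bound n \<alpha> s = block_bound \<alpha> s n" for s
      using 1 powr_minus[of "s n" "\<alpha> - real n"]
      by (simp add: sphere_bound_def block_bound_def field_simps)
    show thesis
    \<comment> \<open>Here \<open>k = n\<close>: the whole range is a tail, so no head estimate
      enters.\<close>
    proof (rule that[of "1 / \<alpha>" "1 / (\<alpha> - real n + 1)"])
      fix s assume s: "decreasing_positive n s"
      show "0 < sphere_bound n \<alpha> s"
        unfolding eq using s n by (rule block_bound_pos) simp
      show "ennreal (1 / \<alpha> * sphere_bound n \<alpha> s)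
        \<le> (\<integral>\<^sup>+t. ennreal (radial_density n \<alpha> s t) * indicator {s n..} t \<partial>lborel)"
        unfolding eq using nn_integral_radial_density_ge_block[OF s n _ \<alpha>] by simp
      show "(\<integral>\<^sup>+t. ennreal (radial_density n \<alpha> s t) * indicator {s n..} t \<partial>lborel)
        \<le> ennreal (1 / (\<alpha> - real n + 1) * sphere_bound n \<alpha> s)"
        unfolding eq using nn_integral_radial_density_tail[OF s n, of \<alpha>] 1 by simp
    qed (use 1 \<alpha> in auto)
  next
    case 2
    have kn: "k \<le> n" using 2 k\<alpha> by linarith
    have lt: "\<alpha> < real k" using 2 k\<alpha>
      by (metis Ints_of_nat order_le_less)
    have eq: "sphere_bound n \<alpha> s = block_bound \<alpha> s k" for s
      using 2 powr_minus[of "s k" "\<alpha> - real k"]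
      by (simp add: sphere_bound_def block_bound_def k_def[symmetric] Let_def field_simps)
    show thesis
    proof (rule that[of "1 / \<alpha>" "1 / (real k - \<alpha>) + 1 / (\<alpha> - real k + 1)"])
      fix s assume s: "decreasing_positive n s"
      have b: "0 < block_bound \<alpha> s k" using s k1 kn by (rule block_bound_pos)
      then show "0 < sphere_bound n \<alpha> s" by (simp add: eq)
      show "ennreal (1 / \<alpha> * sphere_bound n \<alpha> s)
        \<le> (\<integral>\<^sup>+t. ennreal (radial_density n \<alpha> s t) * indicator {s n..} t \<partial>lborel)"
        unfolding eq using nn_integral_radial_density_ge_block[OF s k1 kn \<alpha>] by simp
      \<comment> \<open>The range is split at \<open>s k\<close>. Since \<open>\<alpha>\<close> lies
        strictly between \<open>k - 1\<close> and \<open>k\<close>, both the head and the tail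
        estimate apply at this one point.\<close>
      have "(\<integral>\<^sup>+t. ennreal (radial_density n \<alpha> s t) * indicator {s n..} t \<partial>lborel)
        \<le> (\<integral>\<^sup>+t. ennreal (radial_density n \<alpha> s t) * indicator {0<..s k} t \<partial>lborel)
          + (\<integral>\<^sup>+t. ennreal (radial_density n \<alpha> s t) * indicator {s k..} t \<partial>lborel)"
        using decreasing_positiveD[OF s n] by (intro nn_integral_indicator_Un_le) auto
      also have "\<dots> \<le> ennreal (block_bound \<alpha> s k / (real k - \<alpha>)) + ennreal (block_bound \<alpha> s k / (\<alpha> - real k + 1))"
        using s k1 kn lt k\<alpha>
        by (intro add_mono nn_integral_radial_density_head nn_integral_radial_density_tail) auto
      also have "\<dots> = ennreal ((1 / (real k - \<alpha>) + 1 / (\<alpha> - real k + 1)) * sphere_bound n \<alpha> s)"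
        using b lt k\<alpha> by (simp add: eq ennreal_plus[symmetric] distrib_right del: ennreal_plus)
      finally show "(\<integral>\<^sup>+t. ennreal (radial_density n \<alpha> s t) * indicator {s n..} t \<partial>lborel)
        \<le> ennreal ((1 / (real k - \<alpha>) + 1 / (\<alpha> - real k + 1)) * sphere_bound n \<alpha> s)" .
    qed (use lt k\<alpha> \<alpha> in \<open>auto intro!: add_pos_pos\<close>)
  next
    case 3
    have \<alpha>k: "\<alpha> = real k"
      using 3 \<alpha> by (auto simp: k_def Ints_def)
    have kn: "k < n" using 3 \<alpha>k by simp
    define T where "T s = 1 / (\<Prod>i=1..k. s i)" for s :: "nat \<Rightarrow> real"
    define L where "L s = ln (s k / s (k + 1))" for s :: "nat \<Rightarrow> real"
    have eq: "sphere_bound n \<alpha> s = T s + T s * L s" for s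
      using 3 by (simp add: sphere_bound_def k_def[symmetric] Let_def T_def L_def add_divide_distrib)
    have TL: "0 < T s" "0 \<le> L s" and block: "block_bound \<alpha> s k = T s" "block_bound \<alpha> s (k + 1) = T s"
      if s: "decreasing_positive n s" for s
    proof -
      have sk: "0 < s k" "0 < s (k + 1)" using s k1 kn by (auto intro!: decreasing_positiveD[OF s])
      moreover have "s (k + 1) \<le> s k" using s k1 kn by (auto simp: decreasing_positive_def)
      ultimately show "0 \<le> L s" by (auto simp: L_def pos_le_divide_eq intro!: ln_ge_zero)
      show "0 < T s" using prod_pos_decreasing[OF s, of k] kn by (simp add: T_def)
      show "block_bound \<alpha> s k = T s" "block_bound \<alpha> s (k + 1) = T s"
        using sk by (auto simp: block_bound_def T_def \<alpha>k)
    qed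
    show thesis
    \<comment> \<open>The block and logarithmic lower bounds hold separately, and their maximum is
      at least half their sum, hence the factor 1/2. In the upper bound the head at
      \<open>k + 1\<close> and the tail at \<open>k\<close> each give \<open>T s\<close> and the
      middle gives \<open>T s * L s\<close>, a total of at most twice
      \<open>T s + T s * L s\<close>.\<close>
    proof (rule that[of "min (1 / \<alpha>) 1 / 2" 2])
      fix s assume s: "decreasing_positive n s"
      have TL0: "0 \<le> T s" "0 \<le> T s * L s" using TL[OF s] by auto
      show "0 < sphere_bound n \<alpha> s" unfolding eq using TL(1)[OF s] TL0(2) by (rule add_pos_nonneg)
      let ?U = "\<integral>\<^sup>+t. ennreal (radial_density n \<alpha> s t) * indicator {s n..} t \<partial>lborel"
      have "ennreal (T s / \<alpha>) \<le> ?U"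
        using nn_integral_radial_density_ge_block[OF s k1 _ \<alpha>] kn block[OF s] by simp
      moreover have "ennreal (T s * L s) \<le> ?U"
        using nn_integral_radial_density_ge_log[OF s k1 kn] by (simp add: \<alpha>k T_def L_def)
      ultimately have "ennreal (max (T s / \<alpha>) (T s * L s)) \<le> ?U"
        by (simp add: max_def)
      moreover have "min (1 / \<alpha>) 1 / 2 * sphere_bound n \<alpha> s \<le> max (T s / \<alpha>) (T s * L s)"
      proof -
        have "min (1 / \<alpha>) 1 * T s \<le> 1 / \<alpha> * T s" "min (1 / \<alpha>) 1 * (T s * L s) \<le> 1 * (T s * L s)"
          using TL0 by (intro mult_right_mono; simp)+
        then have "min (1 / \<alpha>) 1 * T s \<le> max (T s / \<alpha>) (T s * L s)"
          "min (1 / \<alpha>) 1 * (T s * L s) \<le> max (T s / \<alpha>) (T s * L s)"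
          by auto
        then show ?thesis by (simp add: eq distrib_left)
      qed
      ultimately show "ennreal (min (1 / \<alpha>) 1 / 2 * sphere_bound n \<alpha> s) \<le> ?U"
        by (meson ennreal_leI order_trans)
      \<comment> \<open>The range is split at \<open>s (k + 1)\<close> and \<open>s k\<close>; the
        pieces share endpoints, which is harmless for an upper bound.\<close>
      have "?U \<le> (\<integral>\<^sup>+t. ennreal (radial_density n \<alpha> s t) * indicator ({0<..s (k + 1)} \<union> {s (k + 1)..s k}) t \<partial>lborel)
          + (\<integral>\<^sup>+t. ennreal (radial_density n \<alpha> s t) * indicator {s k..} t \<partial>lborel)"
        using decreasing_positiveD[OF s n] by (intro nn_integral_indicator_Un_le) auto
      also have "\<dots> \<le> (\<integral>\<^sup>+t. ennreal (radial_density n \<alpha> s t) * indicator {0<..s (k + 1)} t \<partial>lborel)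
        + (\<integral>\<^sup>+t. ennreal (radial_density n \<alpha> s t) * indicator {s (k + 1)..s k} t \<partial>lborel)
          + (\<integral>\<^sup>+t. ennreal (radial_density n \<alpha> s t) * indicator {s k..} t \<partial>lborel)"
        by (intro add_right_mono nn_integral_indicator_Un_le) auto
      also have "\<dots> \<le> ennreal (T s) + ennreal (T s * L s) + ennreal (T s)"
        using nn_integral_radial_density_head[OF s, of "k + 1" \<alpha>] nn_integral_radial_density_tail[OF s k1, of \<alpha>]
          nn_integral_radial_density_middle_le[OF s k1 kn] kn block[OF s]
        by (intro add_mono) (simp_all add: T_def L_def \<alpha>k)
      also have "\<dots> \<le> ennreal (2 * sphere_bound n \<alpha> s)"
        using TL[OF s] by (simp add: eq ennreal_plus[symmetric] del: ennreal_plus)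
      finally show "?U \<le> ennreal (2 * sphere_bound n \<alpha> s)" .
    qed (use \<alpha> in auto)
  qed
qed

section \<open>From the spherical integral to the radial integral\<close>

lemma diag_matrix_mult_nth:
  "(diag_matrix e s *v x) $ i = s (the_inv_into {1..CARD('n)} e i) * (x :: real^'n::finite) $ i"
  by (simp add: diag_matrix_def matrix_vector_mult_def if_distrib[of "\<lambda>y. y * _"] cong: if_cong)

theorem lemma3p1:
  fixes \<alpha> :: real
  assumes "\<alpha> > 0"
  shows "\<exists>c C. 0 < c \<and> 0 < C \<and>
    (\<forall>(e :: nat \<Rightarrow> 'n::finite) (s :: nat \<Rightarrow> real).
       bij_betw e {1..CARD('n)} UNIV \<longrightarrow>
       (\<forall>i j. 1 \<le> i \<and> i \<le> j \<and> j \<le> CARD('n) \<longrightarrow> s i \<ge> s j) \<longrightarrow>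
       s CARD('n) > 0 \<longrightarrow>
       (let I = (LINT x|sphere_measure. 1 / norm (diag_matrix e s *v x) powr \<alpha>);
            R = sphere_bound CARD('n) \<alpha> s
        in c \<le> I / R \<and> I / R \<le> C))"
proof -
  define n where "n = CARD('n)"
  have n: "1 \<le> n" by (simp add: n_def Suc_leI)
  obtain c C where cC: "0 < c" "0 < C"
    and R0: "\<And>s. decreasing_positive n s \<Longrightarrow> 0 < sphere_bound n \<alpha> s"
    and lower: "\<And>s. decreasing_positive n s \<Longrightarrow> ennreal (c * sphere_bound n \<alpha> s)
        \<le> (\<integral>\<^sup>+t. ennreal (radial_density n \<alpha> s t) * indicator {s n..} t \<partial>lborel)"
    and upper: "\<And>s. decreasing_positive n s \<Longrightarrow>
        (\<integral>\<^sup>+t. ennreal (radial_density n \<alpha> s t) * indicator {s n..} t \<partial>lborel)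
        \<le> ennreal (C * sphere_bound n \<alpha> s)"
    by (rule nn_integral_radial_density_bounds[OF assms n], rule that)
  define N where "N = real n"
  have N: "1 \<le> N" using n by (simp add: N_def)
  \<comment> \<open>In both constants \<open>\<alpha>\<close> comes from the layer-cake formula and
    the factor in \<open>N\<close> and \<open>n\<close> from the box estimates. The extra
    \<open>(2 * N) powr - \<alpha>\<close> in \<open>k\<close> pays for the enlarged level
    \<open>2 * N * t\<close> in the lower box estimate.\<close>
  define K where "K = \<alpha> * (N * 2 ^ n)"
  define k where "k = (2 * N) powr - \<alpha> * (\<alpha> * (N * (1 / (4 * N)) ^ n))"
  have K: "0 < K" and k: "0 < k"
    using N assms by (auto simp: K_def k_def)
  have main: "k * c \<le> I / sphere_bound n \<alpha> s \<and> I / sphere_bound n \<alpha> s \<le> K * C"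
    if e: "bij_betw e {1..n} UNIV" and s: "decreasing_positive n s"
      and I: "I = (LINT x|sphere_measure. 1 / norm (diag_matrix e s *v x) powr \<alpha>)"
    for e :: "nat \<Rightarrow> 'n" and s I
  proof -
    define A where "A = diag_matrix e s"
    define w where "w i = s (the_inv_into {1..n} e i)" for i
    define P where "P t = (\<Prod>i=1..n. min 1 (t / s i))" for t
    define R where "R = sphere_bound n \<alpha> s"
    define U where "U = (\<integral>\<^sup>+t. ennreal (radial_density n \<alpha> s t) * indicator {s n..} t \<partial>lborel)"
    define F where "F = (\<integral>\<^sup>+x. ennreal (norm (A *v x) powr - \<alpha>) \<partial>sphere_measure)"
    have A: "(A *v x) $ i = w i * x $ i" for x i
      by (simp add: A_def w_def n_def diag_matrix_mult_nth)
    have inv_mem: "the_inv_into {1..n} e i \<in> {1..n}" for i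
      using e by (intro the_inv_into_into) (auto simp: bij_betw_def)
    have sn: "0 < s n" using s by (simp add: decreasing_positive_def)
    have wn: "s n \<le> w i" for i
      using inv_mem[of i] s by (auto simp: w_def decreasing_positive_def)
    have w0: "0 < w i" for i using wn[of i] sn by linarith
    have we: "w (e j) = s j" if "j \<in> {1..n}" for j
      using that e by (simp add: w_def the_inv_into_f_f bij_betw_def)
    \<comment> \<open>The box estimates are indexed by coordinates and the radial bounds by
      \<open>1..n\<close>; the numbering \<open>e\<close> carries one product to the other.\<close>
    have P_eq: "(\<Prod>i\<in>UNIV. min 1 (t / w i)) = P t" for t
    proof -
      have "(\<Prod>i\<in>UNIV. min 1 (t / w i)) = (\<Prod>j=1..n. min 1 (t / w (e j)))"
        using prod.reindex_bij_betw[OF e, of "\<lambda>i. min 1 (t / w i)"] by simp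
      also have "\<dots> = P t"
        unfolding P_def by (rule prod.cong) (auto simp: we)
      finally show ?thesis .
    qed
    \<comment> \<open>The least diagonal entry is \<open>s n\<close>. This gives the positivity
      needed for the layer-cake formula and makes the sublevel sets empty for
      \<open>t < s n\<close>.\<close>
    have A_ge: "s n \<le> norm (A *v x)" if "x \<in> sphere 0 1" for x
    proof -
      have "norm (s n *\<^sub>R x) \<le> norm (A *v x)"
        using sn by (intro norm_le_componentwise_cart)
          (auto simp: A abs_mult intro!: mult_right_mono order_trans[OF wn abs_ge_self])
      then show ?thesis using that sn by simp
    qed
    have meas: "(\<lambda>x. norm (A *v x)) \<in> borel_measurable sphere_measure"
    proof -
      have "(\<lambda>x. norm (A *v x)) \<in> borel_measurable borel"
        by (intro borel_measurable_continuous_onI continuous_intros matrix_vector_mult_linear_continuous_on)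
      then have "(\<lambda>x. norm (A *v x)) \<in> borel_measurable (restrict_space borel (sphere 0 1))"
        by (rule measurable_restrict_space1)
      then show ?thesis
        by (subst measurable_cong_sets[OF sets_sphere_measure refl])
    qed
    \<comment> \<open>The scale \<open>r\<close> is 1 for the upper bound and \<open>2 * N\<close>
      for the lower one, where it turns level \<open>t\<close> into the enlarged level.\<close>
    have layer: "(\<integral>\<^sup>+x. ennreal ((norm (A *v x) / r) powr - \<alpha>) \<partial>sphere_measure) =
      (\<integral>\<^sup>+t. ennreal (\<alpha> * t powr (- \<alpha> - 1)) * emeasure sphere_measure {x \<in> sphere 0 1. norm (A *v x) \<le> r * t} \<partial>lborel)"
      if r: "0 < r" for r
    proof -
      have sf: "sigma_finite_measure (sphere_measure :: (real^'n) measure)"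
        using sphere_measure_finite by (rule finite_measure.axioms(1))
      have "(\<lambda>x. norm (A *v x) / r) \<in> borel_measurable sphere_measure"
        using meas by measurable
      moreover have "0 < norm (A *v x) / r" if "x \<in> space sphere_measure" for x
        using A_ge[of x] that sn r by (intro divide_pos_pos) auto
      ultimately show ?thesis
        using nn_integral_powr_minus_layer_cake[OF sf _ _ assms, of "\<lambda>x. norm (A *v x) / r"] r
        by (simp add: pos_divide_le_eq mult.commute)
    qed
    have U_cmult: "(\<integral>\<^sup>+t. ennreal a * (ennreal (radial_density n \<alpha> s t) * indicator {s n..} t) \<partial>lborel) = ennreal a * U" for a
      unfolding U_def by (intro nn_integral_cmult) measurable
    have rd: "radial_density n \<alpha> s t = t powr (- \<alpha> - 1) * P t" for t
      by (simp add: radial_density_def P_def)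
    have P0: "0 \<le> P t" if "0 < t" for t
      unfolding P_def using that
      by (intro prod_nonneg) (auto intro!: divide_nonneg_nonneg less_imp_le[OF decreasing_positiveD[OF s]])
    have "F = (\<integral>\<^sup>+t. ennreal (\<alpha> * t powr (- \<alpha> - 1)) * emeasure sphere_measure {x \<in> sphere 0 1. norm (A *v x) \<le> t} \<partial>lborel)"
      unfolding F_def using layer[of 1] by simp
    also have "\<dots> \<le> (\<integral>\<^sup>+t. ennreal K * (ennreal (radial_density n \<alpha> s t) * indicator {s n..} t) \<partial>lborel)"
    proof (rule nn_integral_mono)
      fix t :: real
      show "ennreal (\<alpha> * t powr (- \<alpha> - 1)) * emeasure sphere_measure {x \<in> sphere 0 1. norm (A *v x) \<le> t}
        \<le> ennreal K * (ennreal (radial_density n \<alpha> s t) * indicator {s n..} t)"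
      proof (cases "s n \<le> t")
        case True
        then have t: "0 < t" using sn by linarith
        have "emeasure sphere_measure {x \<in> sphere 0 1. norm (A *v x) \<le> t} \<le> ennreal (N * 2 ^ n * P t)"
          using sublevel_sphere_measure_le[of A w t, OF A w0 t] by (simp add: P_eq N_def n_def)
        then have "ennreal (\<alpha> * t powr (- \<alpha> - 1)) * emeasure sphere_measure {x \<in> sphere 0 1. norm (A *v x) \<le> t}
          \<le> ennreal (\<alpha> * t powr (- \<alpha> - 1)) * ennreal (N * 2 ^ n * P t)"
          by (rule mult_left_mono) simp
        also have "\<dots> = ennreal K * ennreal (radial_density n \<alpha> s t)"
          using N assms P0[OF t] K
          by (simp add: ennreal_mult[symmetric] rd K_def mult_ac)
        finally show ?thesis using True by simp
      next
        case False
        then have "{x \<in> sphere 0 1. norm (A *v x) \<le> t} = {}" using A_ge by fastforce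
        then show ?thesis by (simp only: emeasure_empty) simp
      qed
    qed
    also have "\<dots> \<le> ennreal K * ennreal (C * R)"
      unfolding U_cmult using upper[OF s] unfolding U_def R_def by (intro mult_left_mono) auto
    also have "\<dots> = ennreal (K * C * R)"
      using K cC R0[OF s] by (simp add: ennreal_mult[symmetric] R_def mult.assoc)
    finally have F_le: "F \<le> ennreal (K * C * R)" .
    define d where "d = \<alpha> * (N * (1 / (4 * N)) ^ n)"
    have d: "0 < d" using N assms by (simp add: d_def)
    have "ennreal d * U = (\<integral>\<^sup>+t. ennreal d * (ennreal (radial_density n \<alpha> s t) * indicator {s n..} t) \<partial>lborel)"
      by (rule U_cmult[symmetric])
    also have "\<dots> \<le> (\<integral>\<^sup>+t. ennreal (\<alpha> * t powr (- \<alpha> - 1)) * emeasure sphere_measure {x \<in> sphere 0 1. norm (A *v x) \<le> 2 * N * t} \<partial>lborel)"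
    proof (rule nn_integral_mono)
      fix t :: real
      show "ennreal d * (ennreal (radial_density n \<alpha> s t) * indicator {s n..} t)
        \<le> ennreal (\<alpha> * t powr (- \<alpha> - 1)) * emeasure sphere_measure {x \<in> sphere 0 1. norm (A *v x) \<le> 2 * N * t}"
      proof (cases "s n \<le> t")
        case True
        then have t: "0 < t" using sn by linarith
        \<comment> \<open>The distinguished coordinate of the box is \<open>e n\<close>, the one
          with weight \<open>s n\<close>, so that the required bound \<open>w m \<le> t\<close>
          becomes \<open>s n \<le> t\<close>.\<close>
        have wt: "w (e n) \<le> t" using True n by (subst we) auto
        have Q: "ennreal (N * (1 / (4 * N)) ^ n * P t)
          \<le> emeasure sphere_measure {x \<in> sphere 0 1. norm (A *v x) \<le> 2 * N * t}"
          using sublevel_sphere_measure_ge[of A w "e n" t, OF A w0 wt]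
          unfolding P_eq N_def n_def by simp
        have "ennreal d * ennreal (radial_density n \<alpha> s t) =
          ennreal (\<alpha> * t powr (- \<alpha> - 1)) * ennreal (N * (1 / (4 * N)) ^ n * P t)"
          using N assms P0[OF t] d
          by (simp add: ennreal_mult[symmetric] rd d_def mult_ac)
        also have "\<dots> \<le> ennreal (\<alpha> * t powr (- \<alpha> - 1)) * emeasure sphere_measure {x \<in> sphere 0 1. norm (A *v x) \<le> 2 * N * t}"
          using Q by (rule mult_left_mono) simp
        finally show ?thesis using True by simp
      qed simp
    qed
    also have "\<dots> = (\<integral>\<^sup>+x. ennreal ((norm (A *v x) / (2 * N)) powr - \<alpha>) \<partial>sphere_measure)"
      using N by (intro layer[symmetric]) auto
    finally have dU: "ennreal d * U \<le> \<dots>" .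
    have "ennreal (k * c * R) = ennreal ((2 * N) powr - \<alpha>) * (ennreal d * ennreal (c * R))"
      using d cC R0[OF s] by (simp add: ennreal_mult[symmetric] k_def d_def[symmetric] R_def mult.assoc)
    also have "\<dots> \<le> ennreal ((2 * N) powr - \<alpha>) * (ennreal d * U)"
      using lower[OF s] unfolding U_def R_def by (intro mult_left_mono) auto
    also have "\<dots> \<le> ennreal ((2 * N) powr - \<alpha>) * (\<integral>\<^sup>+x. ennreal ((norm (A *v x) / (2 * N)) powr - \<alpha>) \<partial>sphere_measure)"
      using dU by (rule mult_left_mono) simp
    \<comment> \<open>The factor \<open>(2 * N) powr - \<alpha>\<close> cancels the scaling of the
      norm by \<open>1 / (2 * N)\<close>.\<close>
    also have "\<dots> = F"
      unfolding F_def using meas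
      by (subst nn_integral_cmult[symmetric]) (use N in \<open>auto intro!: nn_integral_cong simp: ennreal_mult[symmetric] powr_divide\<close>)
    finally have F_ge: "ennreal (k * c * R) \<le> F" .
    \<comment> \<open>As \<open>enn2real\<close> sends \<open>top\<close> to 0, this equation alone
      does not recover \<open>F\<close> from \<open>I\<close>; the upper bound \<open>F_le\<close>
      supplies the finiteness that does.\<close>
    have "I = enn2real F"
      unfolding I F_def A_def[symmetric] powr_minus_divide using meas
      by (intro integral_eq_nn_integral) auto
    moreover have "F < top"
      using F_le by (rule order_le_less_trans) simp
    ultimately have FI: "F = ennreal I" "0 \<le> I" by auto
    have R: "0 < R" using R0[OF s] by (simp add: R_def)
    have "k * c * R \<le> I" using F_ge FI by simp
    moreover have "I \<le> K * C * R"
      using F_le K cC R unfolding FI(1) by (subst (asm) ennreal_le_iff) auto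
    ultimately show ?thesis
      using R unfolding R_def[symmetric] by (simp add: pos_le_divide_eq pos_divide_le_eq)
  qed
  show ?thesis
  proof (rule exI[of _ "k * c"], rule exI[of _ "K * C"], intro conjI allI impI)
    fix e :: "nat \<Rightarrow> 'n" and s :: "nat \<Rightarrow> real"
    assume "bij_betw e {1..CARD('n)} UNIV"
      and "\<forall>i j. 1 \<le> i \<and> i \<le> j \<and> j \<le> CARD('n) \<longrightarrow> s j \<le> s i" and "0 < s CARD('n)"
    then show "let I = (LINT x|sphere_measure. 1 / norm (diag_matrix e s *v x) powr \<alpha>);
            R = sphere_bound CARD('n) \<alpha> s
        in k * c \<le> I / R \<and> I / R \<le> K * C"
      using main[of e s] unfolding Let_def n_def decreasing_positive_def by blast
  qed (use k K cC in auto)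
qed

end
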